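(* Let $P$ be a poset, let $N$ and $k$ be positive integers, and let $\mathcal{Q}\subseteq B_N$ be a family of subsets of $[N]$. If \[ k\,L_N(P;\mathcal{Q})<N+1-\operatorname{lu}_N(\mathcal{Q}), \] then $\operatorname{R}_k(\mathcal{B}\,|\,P)\le N$.
   Context: $B_N$ denotes the Boolean lattice of all subsets of $[N]=\{1,\dots,N\}$ ordered by inclusion. A copy of a poset $P$ in a family $\mathcal{F}\subseteq B_N$ is an injection $f:P\to\mathcal{F}$ with $f(x)\subseteq f(y)$ whenever $x\le y$ in $P$; $\mathcal{F}$ is $P$-free if it contains no copy of $P$. The Lubell function of $\mathcal{F}\subseteq B_N$ is $\operatorname{lu}_N(\mathcal{F})=\sum_{F\in\mathcal{F}}\binom{N}{|F|}^{-1}$. For $\mathcal{Q}\subseteq B_N$, $L_N(P;\mathcal{Q})=\max\{\operatorname{lu}_N(\mathcal{F}):\mathcal{F}\subseteq B_N\setminus\mathcal{Q},\ \mathcal{F}\text{ is }P\text{-free}\}$. $\operatorname{R}_k(\mathcal{B}\,|\,P)$ is the smallest integer $n$ such that for every assignment of one of $k$ colors to each element of $B_n$ there is a copy of $P$ in $B_n$ all of whose (image) elements have the same color. *)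

theory Defs
  imports Complex_Main "HOL-Library.Extended_Nat" "HOL-Library.FuncSet"
begin

definition boolean_lattice :: "nat \<Rightarrow> nat set set" where
  "boolean_lattice N = Pow {1..N}"

text \<open>
  A poset is a carrier \<open>P\<close> with a relation \<open>r\<close> such that \<open>partial_order_on P r\<close>;
  \<open>(x, y) \<in> r\<close> means that \<open>x\<close> is below or equal to \<open>y\<close>.
  Copies are weak: inclusions between images need not come from \<open>r\<close>.
\<close>

definition is_copy :: "'a set \<Rightarrow> 'a rel \<Rightarrow> nat set set \<Rightarrow> ('a \<Rightarrow> nat set) \<Rightarrow> bool" where
  "is_copy P r \<F> f \<longleftrightarrow>
     inj_on f P \<and> f ` P \<subseteq> \<F> \<and> (\<forall>x\<in>P. \<forall>y\<in>P. (x, y) \<in> r \<longrightarrow> f x \<subseteq> f y)"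

definition poset_free :: "'a set \<Rightarrow> 'a rel \<Rightarrow> nat set set \<Rightarrow> bool" where
  "poset_free P r \<F> \<longleftrightarrow> (\<nexists>f. is_copy P r \<F> f)"

definition lubell :: "nat \<Rightarrow> nat set set \<Rightarrow> real" where
  "lubell N \<F> = (\<Sum>F\<in>\<F>. 1 / real (N choose card F))"

text \<open>
  The maximum is over a finite set, which is nonempty if \<open>P\<close> is (the empty family is then
  free of \<open>P\<close>). For empty \<open>P\<close> no family is free and the value is unspecified.
\<close>

definition max_lubell :: "nat \<Rightarrow> 'a set \<Rightarrow> 'a rel \<Rightarrow> nat set set \<Rightarrow> real" where
  "max_lubell N P r \<Q> =
     Max {lubell N \<F> | \<F>. \<F> \<subseteq> boolean_lattice N - \<Q> \<and> poset_free P r \<F>}"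

definition boolean_ramsey_property :: "nat \<Rightarrow> 'a set \<Rightarrow> 'a rel \<Rightarrow> nat \<Rightarrow> bool" where
  "boolean_ramsey_property k P r n \<longleftrightarrow>
     (\<forall>c \<in> boolean_lattice n \<rightarrow> {1..k}.
        \<exists>f. is_copy P r (boolean_lattice n) f \<and> (\<exists>i. \<forall>x\<in>P. c (f x) = i))"

text \<open>
  The value is \<open>\<infinity>\<close> if no \<open>n\<close> has the property (for instance if \<open>P\<close> is infinite), so a finite
  upper bound includes existence.
\<close>

definition boolean_ramsey :: "nat \<Rightarrow> 'a set \<Rightarrow> 'a rel \<Rightarrow> enat" where
  "boolean_ramsey k P r = Inf {enat n | n. boolean_ramsey_property k P r n}"

end

theory Submission
  imports Defs
begin

text \<open>Each of the \<open>N + 1\<close> levels of the lattice has Lubell weight 1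
  (\<open>lubell_boolean_lattice\<close>), so the sets outside \<open>\<Q>\<close> weigh
  \<open>N + 1 - lubell N \<Q>\<close>. A coloring without a monochromatic copy of \<open>P\<close>
  splits them into \<open>k\<close> classes free of \<open>P\<close>, each of weight at most
  \<open>max_lubell N P r \<Q>\<close> (\<open>lubell_le_max_lubell\<close>). Adding up contradicts
  the assumed strict inequality.\<close>

lemma finite_boolean_lattice [simp]: "finite (boolean_lattice N)"
  by (simp add: boolean_lattice_def)

lemma lubell_boolean_lattice: "lubell N (boolean_lattice N) = real N + 1"
proof -
  let ?w = "\<lambda>F. 1 / real (N choose card F)"
  have "card ` boolean_lattice N \<subseteq> {..N}"
    by (auto simp: boolean_lattice_def dest: card_mono [rotated])
  then have "lubell N (boolean_lattice N) =
      (\<Sum>m\<le>N. \<Sum>F\<in>{F \<in> boolean_lattice N. card F = m}. ?w F)"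
    unfolding lubell_def by (intro sum.group [symmetric]) auto
  also have "\<dots> = (\<Sum>m\<le>N. 1)"
  proof (rule sum.cong)
    fix m assume "m \<in> {..N}"
    moreover have "card {F \<in> boolean_lattice N. card F = m} = N choose m"
      using n_subsets [of "{1..N}" m] by (simp add: boolean_lattice_def)
    \<comment> \<open>Since \<open>m \<le> N\<close>, the coefficient \<open>N choose m\<close> is
      nonzero and cancels.\<close>
    ultimately show "(\<Sum>F\<in>{F \<in> boolean_lattice N. card F = m}. ?w F) = 1"
      by simp
  qed simp
  finally show ?thesis by simp
qed

text \<open>\<open>Max\<close> bounds its elements only over a finite set; here the values come from
  subfamilies of a finite lattice.\<close>

lemma lubell_le_max_lubell:
  assumes "\<F> \<subseteq> boolean_lattice N - \<Q>" and "poset_free P r \<F>"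
  shows "lubell N \<F> \<le> max_lubell N P r \<Q>"
proof -
  have "finite {lubell N \<F> | \<F>. \<F> \<subseteq> boolean_lattice N - \<Q> \<and> poset_free P r \<F>}"
    by (rule finite_surj [of "Pow (boolean_lattice N)" _ "lubell N"]) auto
  then show ?thesis
    unfolding max_lubell_def by (rule Max_ge) (use assms in auto)
qed

lemma boolean_ramsey_propertyI_lubell:
  assumes \<Q>: "\<Q> \<subseteq> boolean_lattice N"
    and less: "real k * max_lubell N P r \<Q> < real N + 1 - lubell N \<Q>"
  shows "boolean_ramsey_property k P r N"
  unfolding boolean_ramsey_property_def
proof (rule ballI, rule ccontr)
  fix c assume c: "c \<in> boolean_lattice N \<rightarrow> {1..k}"
    and no_copy: "\<nexists>f. is_copy P r (boolean_lattice N) f \<and> (\<exists>i. \<forall>x\<in>P. c (f x) = i)"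
  define \<F> where "\<F> i = {F \<in> boolean_lattice N - \<Q>. c F = i}" for i
  \<comment> \<open>A copy inside one color class would be monochromatic. For empty
    \<open>P\<close>, \<open>no_copy\<close> is already contradictory, so the unspecified value of
    \<open>max_lubell\<close> does no harm.\<close>
  have "poset_free P r (\<F> i)" for i
    unfolding poset_free_def
  proof
    assume "\<exists>f. is_copy P r (\<F> i) f"
    then obtain f where "is_copy P r (\<F> i) f" ..
    then have "is_copy P r (boolean_lattice N) f" and "\<forall>x\<in>P. c (f x) = i"
      by (auto simp: is_copy_def \<F>_def)
    with no_copy show False by blast
  qed
  then have bound: "lubell N (\<F> i) \<le> max_lubell N P r \<Q>" for i
    by (intro lubell_le_max_lubell) (auto simp: \<F>_def)
  have "real N + 1 - lubell N \<Q> = lubell N (boolean_lattice N - \<Q>)"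
    unfolding lubell_boolean_lattice [symmetric] lubell_def
    by (rule sum_diff [symmetric]) (use \<Q> in auto)
  \<comment> \<open>All colors lie in \<open>{1..k}\<close>, so the classes partition the complement
    of \<open>\<Q>\<close>.\<close>
  also have "\<dots> = (\<Sum>i=1..k. lubell N (\<F> i))"
    unfolding lubell_def \<F>_def using c by (intro sum.group [symmetric]) auto
  also have "\<dots> \<le> real k * max_lubell N P r \<Q>"
    using sum_bounded_above [of "{1..k}" "\<lambda>i. lubell N (\<F> i)"] bound by simp
  finally show False
    using less by simp
qed

theorem theorem3p2:
  fixes P :: "'a set" and r :: "'a rel" and N k :: nat and \<Q> :: "nat set set"
  assumes "partial_order_on P r"
    and "N > 0" and "k > 0"
    and "\<Q> \<subseteq> boolean_lattice N"
    and "real k * max_lubell N P r \<Q> < real N + 1 - lubell N \<Q>"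
  shows "boolean_ramsey k P r \<le> enat N"
  unfolding boolean_ramsey_def
  using boolean_ramsey_propertyI_lubell [OF assms(4,5)] by (intro Inf_lower) auto

end
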